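(* Let $N\in\{1,2,3\}$. If $B=(\beta_{ij})_{ij}\in S(n)$ is strictly cubically copositive, then the system $$-\Delta u_i=\sum_{j=1}^n\beta_{ij}u_j^2u_i,\qquad u_1,\dots,u_n\ge 0\qquad\text{in }\mathbb{R}^N\qquad(i=1,\dots,n)$$ does not admit a nontrivial solution.
   Context: $S(n)$ denotes the space of symmetric $n\times n$ matrices with real coefficients, and $C^n_+=\{c\in\mathbb{R}^n: c_i\ge 0 \text{ for all } i\}$. A matrix $B=(\beta_{ij})_{ij}\in S(n)$ is called strictly cubically copositive if there exists $\mu\in C^n_+$ such that $\sum_{i,j=1}^n\beta_{ij}c_j^2c_i\mu_i>0$ for all $c\in C^n_+\setminus\{0\}$. A solution $u=(u_1,\dots,u_n)$ of the system (all components nonnegative) is called nontrivial if $u_i\not\equiv 0$ for at least one $i$. *)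

theory Defs
  imports "HOL-Analysis.Analysis"
begin

definition nonneg_cone :: "(real ^ 'n) set" where
  "nonneg_cone = {c. \<forall>i. c $ i \<ge> 0}"

definition symmetric_matrix :: "real ^ 'n ^ 'n \<Rightarrow> bool" where
  "symmetric_matrix B \<longleftrightarrow> transpose B = B"

definition strictly_cubically_copositive :: "real ^ 'n ^ 'n \<Rightarrow> bool" where
  "strictly_cubically_copositive B \<longleftrightarrow>
     (\<exists>\<mu>\<in>nonneg_cone. \<forall>c\<in>nonneg_cone - {0}.
        (\<Sum>i\<in>UNIV. \<Sum>j\<in>UNIV. B $ i $ j * (c $ j)\<^sup>2 * c $ i * \<mu> $ i) > 0)"

(* frechet_derivative is an arbitrary choice where the function is not differentiable,
   so partial and laplacian are only meaningful together with the predicates C1 and C2. *)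
definition partial :: "'a::euclidean_space \<Rightarrow> ('a \<Rightarrow> real) \<Rightarrow> 'a \<Rightarrow> real" where
  "partial b f x = frechet_derivative f (at x) b"

definition C1 :: "('a::euclidean_space \<Rightarrow> real) \<Rightarrow> bool" where
  "C1 f \<longleftrightarrow> (\<forall>x. f differentiable (at x)) \<and> (\<forall>b\<in>Basis. continuous_on UNIV (partial b f))"

definition C2 :: "('a::euclidean_space \<Rightarrow> real) \<Rightarrow> bool" where
  "C2 f \<longleftrightarrow> C1 f \<and> (\<forall>b\<in>Basis. C1 (partial b f))"

definition laplacian :: "('a::euclidean_space \<Rightarrow> real) \<Rightarrow> 'a \<Rightarrow> real" where
  "laplacian f x = (\<Sum>b\<in>Basis. partial b (partial b f) x)"

(* Solutions are understood in the classical sense, on the whole space. *)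
definition nonneg_solution :: "real ^ 'n ^ 'n \<Rightarrow> ('n \<Rightarrow> 'a::euclidean_space \<Rightarrow> real) \<Rightarrow> bool" where
  "nonneg_solution B u \<longleftrightarrow>
     (\<forall>i. C2 (u i)) \<and> (\<forall>i x. u i x \<ge> 0) \<and>
     (\<forall>i x. - laplacian (u i) x = (\<Sum>j\<in>UNIV. B $ i $ j * (u j x)\<^sup>2 * u i x))"

definition nontrivial :: "('n \<Rightarrow> 'a \<Rightarrow> real) \<Rightarrow> bool" where
  "nontrivial u \<longleftrightarrow> (\<exists>i. u i \<noteq> (\<lambda>x. 0))"

end

theory Submission
  imports Defs
begin

text \<open>
  Let \<open>\<mu>\<close> be a weight vector witnessing copositivity and put \<open>v = \<Sum>\<^sub>i \<mu>\<^sub>i u\<^sub>i\<close>. Summing the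
  equations with weights \<open>\<mu>\<^sub>i\<close> shows that \<open>- \<Delta>v\<close> is the weighted cubic form evaluated at
  \<open>(u\<^sub>1, \<dots>, u\<^sub>n)\<close>. This form is positive on the cone away from the origin and homogeneous of
  degree 3, so it dominates the cube of the norm (\<open>weighted_cubic_form_coercive\<close>), and since
  \<open>v\<close> is at most a constant times that norm, \<open>- \<Delta>v \<ge> \<epsilon> v\<^sup>3\<close> for some \<open>\<epsilon> > 0\<close>. If such a
  \<open>v \<ge> 0\<close> must vanish, then the cubic form vanishes along the solution, and so does the solution.

  The Liouville theorem for \<open>- \<Delta>v \<ge> \<epsilon> v\<^sup>3\<close> in dimension at most 3
  (\<open>cubic_supersolution_eq_0\<close>) is proved with the maximum principle only, by comparison with
  explicit radial functions of \<open>r = |x - p|\<close>. The exponent 3 is critical in dimension 3: the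
  inequality is invariant under \<open>v \<mapsto> \<lambda> v(\<lambda> x)\<close>, and \<open>1/r\<close> scales in the same way. Two
  estimates for the scale invariant quantity \<open>R \<cdot> min\<^bsub>r \<le> R\<^esub> v\<close> contradict each other.

  It is bounded in \<open>R\<close> (\<open>supersolution_lower_bound_on_ball\<close>): the largest
  multiple of the bump \<open>(1 - r\<^sup>2/R\<^sup>2)\<^sup>2\<close> that fits below \<open>v\<close> touches it at a point where the
  inequality can be read off from the Laplacian of the bump.

  It is also unbounded. If \<open>v(p) > 0\<close>, superharmonicity first gives \<open>v \<ge> c/r\<close>
  away from \<open>p\<close>. Then \<open>- \<Delta>v \<ge> \<epsilon> c\<^sup>3/r\<^sup>3\<close>, and as \<open>(c + k log r)/r\<close> has Laplacian \<open>- k/r\<^sup>3\<close> in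
  dimension 3, comparison improves the bound to \<open>v \<ge> (c + k log r)/r\<close> with some \<open>k > 0\<close>. Both
  comparisons are instances of \<open>log_barrier_le_supersolution\<close>.

  All comparison functions are radially decreasing where they matter, and the Laplacian of such a
  function is bounded below by the three-dimensional expression in every dimension at most 3; so
  the three dimensions need not be distinguished.
\<close>

section \<open>The Laplacian at a touching point\<close>

text \<open>
  If the second derivative were negative, the first one would vanish at the minimum and be negative
  just to its right, so the function would drop below its minimal value.
\<close>

lemma second_derivative_nonneg_at_local_min:
  fixes g :: "real \<Rightarrow> real"
  assumes g': "\<forall>\<^sub>F t in nhds a. (g has_real_derivative g' t) (at t)"
    and g'': "(g' has_real_derivative D) (at a)"
    and min: "\<forall>\<^sub>F t in nhds a. g a \<le> g t"
  shows "0 \<le> D"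
proof (rule ccontr)
  assume "\<not> 0 \<le> D"
  then have "D < 0" by simp
  obtain d where d: "d > 0"
    "\<And>t. dist t a < d \<Longrightarrow> (g has_real_derivative g' t) (at t) \<and> g a \<le> g t"
    using eventually_conj[OF g' min] unfolding eventually_nhds_metric by auto
  have "g' a = 0"
    using DERIV_local_min[of g "g' a" a d] d by (auto simp: dist_real_def abs_minus_commute)
  then obtain e where e: "e > 0" "\<And>h. 0 < h \<Longrightarrow> h < e \<Longrightarrow> g' (a + h) < 0"
    using DERIV_neg_dec_right[OF g'' \<open>D < 0\<close>] by auto
  define h where "h = min d e / 2"
  have h: "0 < h" "h < d" "h < e"
    using d e by (auto simp: h_def)
  have "g (a + h) < g a"
  proof (rule DERIV_neg_imp_decreasing_open[where f = g])
    show "\<exists>y. (g has_real_derivative y) (at t) \<and> y < 0" if "a < t" "t < a + h" for t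
      using d(2)[of t] e(2)[of "t - a"] that h by (auto simp: dist_real_def)
    show "continuous_on {a..a + h} g"
    proof (rule DERIV_atLeastAtMost_imp_continuous_on)
      show "\<exists>y. (g has_real_derivative y) (at t)" if "a \<le> t" "t \<le> a + h" for t
        using d(2)[of t] that h by (auto simp: dist_real_def)
    qed
  qed (use h in auto)
  moreover have "g a \<le> g (a + h)"
    using d(2)[of "a + h"] h by (simp add: dist_real_def)
  ultimately show False by simp
qed

lemma partial_along_line:
  fixes f :: "'a::euclidean_space \<Rightarrow> real"
  assumes "f differentiable (at (x + t *\<^sub>R b))"
  shows "((\<lambda>t. f (x + t *\<^sub>R b)) has_real_derivative partial b f (x + t *\<^sub>R b)) (at t)"
proof -
  let ?f' = "frechet_derivative f (at (x + t *\<^sub>R b))"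
  have f: "(f has_derivative ?f') (at (x + t *\<^sub>R b))"
    using assms frechet_derivative_works by blast
  have l: "((\<lambda>t. x + t *\<^sub>R b) has_derivative (\<lambda>h. h *\<^sub>R b)) (at t)"
    by (auto intro!: derivative_eq_intros)
  have "((\<lambda>t. f (x + t *\<^sub>R b)) has_derivative (\<lambda>h. ?f' (h *\<^sub>R b))) (at t)"
    using has_derivative_compose[OF l f] by simp
  moreover have "?f' (h *\<^sub>R b) = partial b f (x + t *\<^sub>R b) * h" for h
    using linear_scale[OF has_derivative_linear[OF f]] by (simp add: partial_def)
  ultimately show ?thesis
    by (simp add: has_field_derivative_def)
qed

text \<open>
  This is the maximum principle in the only form that is used. On each coordinate line through \<open>x\<close>
  the difference of \<open>v\<close> and the radial function has a local minimum, hence a nonnegative second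
  derivative; summing over the coordinates gives the claim, because the left-hand side is the
  Laplacian of \<open>F(|y - p|\<^sup>2)\<close> at \<open>x\<close>. Writing radial functions in terms of the squared distance
  avoids derivatives of the norm.
\<close>

lemma laplacian_ge_at_radial_touching_point:
  fixes v :: "'a::euclidean_space \<Rightarrow> real"
  assumes v: "C2 v"
    and F': "\<forall>\<^sub>F s in nhds ((norm (x - p))\<^sup>2). (F has_real_derivative F' s) (at s)"
    and F'': "(F' has_real_derivative D) (at ((norm (x - p))\<^sup>2))"
    and min: "\<forall>\<^sub>F y in nhds x.
      v x - F ((norm (x - p))\<^sup>2) \<le> v y - F ((norm (y - p))\<^sup>2)"
  shows "4 * (norm (x - p))\<^sup>2 * D + 2 * real DIM('a) * F' ((norm (x - p))\<^sup>2) \<le> laplacian v x"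
proof -
  let ?s = "(norm (x - p))\<^sup>2"
  have dir: "4 * ((x - p) \<bullet> b)\<^sup>2 * D + 2 * F' ?s \<le> partial b (partial b v) x"
    if b: "b \<in> Basis" for b
  proof -
    define S where "S t = ?s + 2 * t * ((x - p) \<bullet> b) + t\<^sup>2" for t :: real
    have S: "(norm (x + t *\<^sub>R b - p))\<^sup>2 = S t" for t
      using b unfolding S_def power2_norm_eq_inner
      by (simp add: inner_simps inner_commute power2_eq_square algebra_simps)
    have S0: "S 0 = ?s" by (simp add: S_def)
    have S': "(S has_real_derivative 2 * ((x - p) \<bullet> b) + 2 * t) (at t)" for t
      unfolding S_def by (auto intro!: derivative_eq_intros)
    have tS: "(S \<longlongrightarrow> ?s) (nhds 0)"
      using DERIV_isCont[OF S'[of 0]] unfolding isCont_def tendsto_at_iff_tendsto_nhds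
      by (simp add: S0)
    have tl: "((\<lambda>t. x + t *\<^sub>R b) \<longlongrightarrow> x) (nhds (0::real))"
    proof -
      have "(\<lambda>t. x + t *\<^sub>R b) \<midarrow>0\<rightarrow> x + 0 *\<^sub>R b"
        by (intro tendsto_intros)
      then show ?thesis
        using tendsto_at_iff_tendsto_nhds[of "\<lambda>t. x + t *\<^sub>R b" "0::real"] by simp
    qed
    let ?g = "\<lambda>t. v (x + t *\<^sub>R b) - F (S t)"
    let ?g' = "\<lambda>t. partial b v (x + t *\<^sub>R b) - F' (S t) * (2 * ((x - p) \<bullet> b) + 2 * t)"
    have 1: "\<forall>\<^sub>F t in nhds 0. (?g has_real_derivative ?g' t) (at t)"
      using eventually_compose_filterlim[OF F' tS]
    proof eventually_elim
      case (elim t)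
      have "v differentiable (at (x + t *\<^sub>R b))"
        using v by (auto simp: C2_def C1_def)
      then show ?case
        by (intro DERIV_diff partial_along_line DERIV_chain2[OF elim S'])
    qed
    have F''0: "(F' has_real_derivative D) (at (S 0))"
      using F'' by (simp add: S0)
    have "partial b v differentiable (at (x + 0 *\<^sub>R b))"
      using v b by (auto simp: C2_def C1_def)
    from partial_along_line[OF this]
    have 2: "(?g' has_real_derivative partial b (partial b v) x
        - (4 * ((x - p) \<bullet> b)\<^sup>2 * D + 2 * F' ?s)) (at 0)"
      by (auto intro!: derivative_eq_intros DERIV_chain2[OF F''0 S'] simp: S0 power2_eq_square)
    have 3: "\<forall>\<^sub>F t in nhds 0. ?g 0 \<le> ?g t"
      using eventually_compose_filterlim[OF min tl] by (simp add: S S0)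
    show ?thesis
      using second_derivative_nonneg_at_local_min[OF 1 2 3] by simp
  qed
  have "(\<Sum>b\<in>Basis. 4 * ((x - p) \<bullet> b)\<^sup>2 * D + 2 * F' ?s) \<le> laplacian v x"
    unfolding laplacian_def by (rule sum_mono) (rule dir)
  also have "(\<Sum>b\<in>Basis. 4 * ((x - p) \<bullet> b)\<^sup>2 * D + 2 * F' ?s)
      = 4 * (\<Sum>b\<in>Basis. ((x - p) \<bullet> b)\<^sup>2) * D + 2 * real DIM('a) * F' ?s"
    by (simp add: sum.distrib sum_distrib_left sum_distrib_right algebra_simps)
  also have "(\<Sum>b\<in>Basis. ((x - p) \<bullet> b)\<^sup>2) = ?s"
    unfolding power2_norm_eq_inner euclidean_inner[of "x - p" "x - p"]
    by (simp add: power2_eq_square)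
  finally show ?thesis .
qed

lemma C2_imp_continuous_on:
  assumes "C2 v" shows "continuous_on S v"
  using assms unfolding C2_def C1_def
  by (meson continuous_at_imp_continuous_on differentiable_imp_continuous_within)


section \<open>Lower barriers in an exterior domain\<close>

text \<open>
  If the barrier exceeded \<open>v\<close> somewhere, then so would the barrier minus a small \<open>\<delta>\<close>. As the
  barrier tends to 0 at infinity, the difference of \<open>v\<close> and the lowered barrier would attain a
  negative minimum in the interior of some annulus. There the Laplacian of \<open>v\<close> would be at least
  that of the barrier, which is at least \<open>- k/r\<^sup>3\<close>.

  The case \<open>k < 0\<close> is allowed on purpose: then the barrier is strictly subharmonic, and the
  hypothesis on \<open>v\<close> holds for every superharmonic function.
\<close>

lemma log_barrier_le_supersolution:
  fixes v :: "'a::euclidean_space \<Rightarrow> real"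
  assumes dim: "DIM('a) \<le> 3" and v: "C2 v" and nonneg: "\<And>x. 0 \<le> v x"
    and r0: "0 < r0" and c: "0 < c" and k: "k \<le> c"
    and inner: "\<And>x. norm (x - p) = r0 \<Longrightarrow> c / r0 \<le> v x"
    and superh: "\<And>x. r0 < norm (x - p) \<Longrightarrow> k / norm (x - p) ^ 3 < - laplacian v x"
    and y: "r0 \<le> norm (y - p)"
  shows "(c + k * ln (norm (y - p) / r0)) / norm (y - p) \<le> v y"
proof (rule ccontr)
  \<comment> \<open>The barrier is \<open>H r = w r / r\<close>; as a function of \<open>s = r\<^sup>2\<close> it has the derivative \<open>J (sqrt s)\<close>.\<close>
  define w where "w r = c + k * ln (r / r0)" for r
  define H where "H r = w r / r" for r
  define J where "J r = (k - w r) / (2 * r ^ 3)" for r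
  assume "\<not> ?thesis"
  then have "v y < H (norm (y - p))" by (simp add: H_def w_def)
  then obtain \<delta> where \<delta>: "0 < \<delta>" "v y < H (norm (y - p)) - \<delta>"
    using that[of "(H (norm (y - p)) - v y) / 2"] by (simp add: field_simps)
  have "((\<lambda>r. (c - k * ln r0) * inverse r + k * (ln r / r)) \<longlongrightarrow> (c - k * ln r0) * 0 + k * 0) at_top"
    by (intro tendsto_intros ln_x_over_x_tendsto_0 tendsto_inverse_0_at_top filterlim_ident)
  then have "\<forall>\<^sub>F r in at_top. (c - k * ln r0) * inverse r + k * (ln r / r) < \<delta>"
    using \<delta> by (intro order_tendstoD(2)) auto
  then obtain R0 where R0: "\<And>r. R0 \<le> r \<Longrightarrow> (c - k * ln r0) * inverse r + k * (ln r / r) < \<delta>"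
    unfolding eventually_at_top_linorder by auto
  define R where "R = max R0 (norm (y - p))"
  have R: "r0 \<le> R" "norm (y - p) \<le> R" using y by (auto simp: R_def)
  have "H R = (c - k * ln r0) * inverse R + k * (ln R / R)"
    using r0 R by (simp add: H_def w_def ln_div field_simps)
  then have HR: "H R < \<delta>" using R0[of R] by (simp add: R_def)
  have w': "(w has_real_derivative k / r) (at r)" if "0 < r" for r
    unfolding w_def using that r0 by (auto intro!: derivative_eq_intros)
  have H': "(H has_real_derivative (k - w r) / r\<^sup>2) (at r)" if "0 < r" for r
    unfolding H_def using that
    by (auto intro!: derivative_eq_intros w' simp: power2_eq_square)
  have J': "(J has_real_derivative (3 * w r - 4 * k) / (2 * r ^ 4)) (at r)" if "0 < r" for r
  proof -
    have "(J has_real_derivative ((0 - k / r) * (2 * r ^ 3) - (k - w r) * (2 * (3 * r ^ 2)))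
        / ((2 * r ^ 3) * (2 * r ^ 3))) (at r)"
      unfolding J_def using that
      by (intro DERIV_divide DERIV_diff DERIV_const w' DERIV_cmult) (auto intro!: derivative_eq_intros)
    also have "((0 - k / r) * (2 * r ^ 3) - (k - w r) * (2 * (3 * r ^ 2))) / ((2 * r ^ 3) * (2 * r ^ 3))
        = (3 * w r - 4 * k) / (2 * r ^ 4)"
      using that by (simp add: field_simps eval_nat_numeral)
    finally show ?thesis .
  qed
  define K where "K = cball p R - ball p r0"
  have K: "x \<in> K \<longleftrightarrow> r0 \<le> norm (x - p) \<and> norm (x - p) \<le> R" for x
    by (auto simp: K_def dist_norm norm_minus_commute)
  have contH: "continuous_on {0<..} H"
    by (intro continuous_at_imp_continuous_on ballI DERIV_isCont[OF H']) simp
  have "continuous_on K (\<lambda>x. H (norm (x - p)))"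
  proof (rule continuous_on_compose2[OF contH])
    show "continuous_on K (\<lambda>x. norm (x - p))" by (intro continuous_intros)
  qed (use r0 in \<open>auto simp: K\<close>)
  then have "continuous_on K (\<lambda>x. v x - H (norm (x - p)))"
    by (intro continuous_on_diff C2_imp_continuous_on[OF v])
  moreover have "compact K" "y \<in> K"
    using y R by (auto simp: K) (simp add: K_def compact_diff)
  ultimately obtain x where x: "x \<in> K"
    and min: "\<And>z. z \<in> K \<Longrightarrow> v x - H (norm (x - p)) \<le> v z - H (norm (z - p))"
    using continuous_attains_inf[of K] by blast
  define r where "r = norm (x - p)"
  have vH: "v x < H r - \<delta>"
    using min[OF \<open>y \<in> K\<close>] \<delta> by (simp add: r_def)
  have "r \<noteq> r0"
    using inner[of x] vH \<delta> r0 by (auto simp: r_def H_def w_def)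
  moreover have "r \<noteq> R"
    using HR vH nonneg[of x] by auto
  ultimately have r: "r0 < r" "r < R" using x by (auto simp: K r_def)
  have "0 < H r" using vH nonneg[of x] \<delta> by linarith
  then have "0 < w r" using r r0 by (simp add: H_def zero_less_divide_iff)
  \<comment> \<open>\<open>H\<close> is decreasing at \<open>r\<close>, which allows the dimension to be replaced by 3 below.\<close>
  have "k \<le> w r"
  proof (cases "0 \<le> k")
    case True
    then have "0 \<le> k * ln (r / r0)" using r r0 by simp
    then show ?thesis using k by (simp add: w_def)
  qed (use \<open>0 < w r\<close> in simp)
  have "r\<^sup>2 > 0" "sqrt (r\<^sup>2) = r" using r r0 by auto
  have touch: "4 * (norm (x - p))\<^sup>2 * ((3 * w r - 4 * k) / (2 * r ^ 4) * (inverse r / 2))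
      + 2 * real DIM('a) * J (sqrt ((norm (x - p))\<^sup>2)) \<le> laplacian v x"
  proof (rule laplacian_ge_at_radial_touching_point[where F = "\<lambda>s. H (sqrt s)" and F' = "\<lambda>s. J (sqrt s)"])
    have "\<forall>\<^sub>F s in nhds (r\<^sup>2). s \<in> {0<..}"
      using \<open>r\<^sup>2 > 0\<close> by (intro eventually_nhds_in_open) auto
    then show "\<forall>\<^sub>F s in nhds ((norm (x - p))\<^sup>2). ((\<lambda>s. H (sqrt s)) has_real_derivative J (sqrt s)) (at s)"
      unfolding r_def[symmetric]
    proof eventually_elim
      case (elim s)
      then have "((\<lambda>s. H (sqrt s)) has_real_derivative (k - w (sqrt s)) / (sqrt s)\<^sup>2 * (inverse (sqrt s) / 2)) (at s)"
        by (intro DERIV_chain2[OF H' DERIV_real_sqrt]) auto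
      then show ?case
        by (simp add: J_def field_simps eval_nat_numeral)
    qed
    show "((\<lambda>s. J (sqrt s)) has_real_derivative (3 * w r - 4 * k) / (2 * r ^ 4) * (inverse r / 2)) (at ((norm (x - p))\<^sup>2))"
      using DERIV_chain2[OF J' DERIV_real_sqrt, of "r\<^sup>2"] \<open>r\<^sup>2 > 0\<close> \<open>sqrt (r\<^sup>2) = r\<close> r r0
      by (simp add: r_def[symmetric])
    have "open {z. r0 < norm (z - p) \<and> norm (z - p) < R}"
      by (intro open_Collect_conj open_Collect_less continuous_intros)
    then have "\<forall>\<^sub>F z in nhds x. z \<in> {z. r0 < norm (z - p) \<and> norm (z - p) < R}"
      using r by (intro eventually_nhds_in_open) (auto simp: r_def)
    then show "\<forall>\<^sub>F z in nhds x. v x - H (sqrt ((norm (x - p))\<^sup>2)) \<le> v z - H (sqrt ((norm (z - p))\<^sup>2))"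
      by eventually_elim (use min in \<open>simp add: K\<close>)
  qed (fact v)
  have "6 * J r \<le> 2 * real DIM('a) * J r"
  proof -
    have "J r \<le> 0" using \<open>k \<le> w r\<close> r r0 by (simp add: J_def divide_nonpos_pos)
    then show ?thesis using dim by (intro mult_right_mono_neg) auto
  qed
  moreover have "4 * r\<^sup>2 * ((3 * w r - 4 * k) / (2 * r ^ 4) * (inverse r / 2)) + 6 * J r = - (k / r ^ 3)"
    using r r0 by (simp add: J_def divide_simps eval_nat_numeral)
  moreover note touch[folded r_def, unfolded \<open>sqrt (r\<^sup>2) = r\<close>]
  ultimately have "- (k / r ^ 3) \<le> laplacian v x"
    by linarith
  then show False
    using superh[of x] r by (simp add: r_def)
qed

section \<open>An upper bound for the minimum over a ball\<close>

text \<open>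
  Let \<open>M \<psi>\<close> be the largest multiple of the bump \<open>\<psi> = (1 - \<sigma>)\<^sup>2\<close>, \<open>\<sigma> = r\<^sup>2/R\<^sup>2\<close>, lying below \<open>v\<close>. At a
  touching point \<open>\<epsilon> v\<^sup>3 \<le> - \<Delta>v \<le> (12 - 20 \<sigma>) M/R\<^sup>2\<close>. So \<open>\<sigma> < 3/5\<close>: near the sphere the bump is
  subharmonic and cannot touch. Away from the sphere \<open>\<psi> \<ge> 4/25\<close>, hence \<open>M\<close> is comparable to the
  value of \<open>v\<close> at the touching point, and \<open>\<epsilon> v\<^sup>2 \<le> 75/R\<^sup>2\<close> there.
\<close>

lemma supersolution_lower_bound_on_ball:
  fixes v :: "'a::euclidean_space \<Rightarrow> real"
  assumes dim: "DIM('a) \<le> 3" and v: "C2 v" and \<epsilon>: "0 < \<epsilon>"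
    and super: "\<And>x. \<epsilon> * v x ^ 3 \<le> - laplacian v x"
    and R: "0 < R" and m: "0 < m" "\<And>x. norm (x - p) \<le> R \<Longrightarrow> m \<le> v x"
  shows "\<epsilon> * (m * R)\<^sup>2 \<le> 75"
proof -
  define \<psi> where "\<psi> s = (1 - s / R\<^sup>2)\<^sup>2" for s
  have vpos: "0 < v x" if "x \<in> cball p R" for x
    using m(1) m(2)[of x] that by (auto simp: dist_norm norm_minus_commute)
  \<comment> \<open>The touching point is where \<open>\<psi>/v\<close> is maximal; unlike \<open>v/\<psi>\<close>, this quotient is continuous up to
    the sphere, where it vanishes.\<close>
  have "continuous_on (cball p R) (\<lambda>x. \<psi> ((norm (x - p))\<^sup>2) / v x)"
    unfolding \<psi>_def
  proof (intro continuous_intros C2_imp_continuous_on[OF v] ballI)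
    show "v x \<noteq> 0" if "x \<in> cball p R" for x using vpos[OF that] by simp
  qed (use R in auto)
  then obtain x where x: "x \<in> cball p R"
    and max: "\<And>z. z \<in> cball p R \<Longrightarrow> \<psi> ((norm (z - p))\<^sup>2) / v z \<le> \<psi> ((norm (x - p))\<^sup>2) / v x"
    using continuous_attains_sup[of "cball p R"] R by fastforce
  define \<sigma> where "\<sigma> = (norm (x - p))\<^sup>2 / R\<^sup>2"
  define M where "M = v x / \<psi> ((norm (x - p))\<^sup>2)"
  have vx: "0 < v x" using vpos x .
  have "0 < \<psi> ((norm (p - p))\<^sup>2) / v p"
    using vpos[of p] R by (simp add: \<psi>_def)
  also have "\<dots> \<le> \<psi> ((norm (x - p))\<^sup>2) / v x" using max[of p] R by simp
  finally have \<psi>x: "0 < \<psi> ((norm (x - p))\<^sup>2)"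
    using vx by (simp add: zero_less_divide_iff)
  then have M: "0 < M" using vx by (simp add: M_def)
  have "norm (x - p) \<noteq> R" using \<psi>x R by (auto simp: \<psi>_def)
  then have xR: "norm (x - p) < R" using x by (auto simp: dist_norm norm_minus_commute)
  have touch: "v x - M * \<psi> ((norm (x - p))\<^sup>2) \<le> v z - M * \<psi> ((norm (z - p))\<^sup>2)" if "norm (z - p) < R" for z
  proof -
    have z: "z \<in> cball p R" using that by (auto simp: dist_norm norm_minus_commute)
    have "M * \<psi> ((norm (z - p))\<^sup>2) \<le> v z"
      using max[OF z] vpos[OF z] vx \<psi>x by (simp add: M_def field_simps)
    moreover have "M * \<psi> ((norm (x - p))\<^sup>2) = v x" using \<psi>x by (simp add: M_def)
    ultimately show ?thesis by simp
  qed
  have lap: "4 * (norm (x - p))\<^sup>2 * (2 * M / R ^ 4)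
      + 2 * real DIM('a) * (- 2 * M / R\<^sup>2 * (1 - (norm (x - p))\<^sup>2 / R\<^sup>2)) \<le> laplacian v x"
  proof (rule laplacian_ge_at_radial_touching_point[where F = "\<lambda>s. M * \<psi> s"
        and F' = "\<lambda>s. - 2 * M / R\<^sup>2 * (1 - s / R\<^sup>2)"])
    show "\<forall>\<^sub>F s in nhds ((norm (x - p))\<^sup>2). ((\<lambda>s. M * \<psi> s) has_real_derivative - 2 * M / R\<^sup>2 * (1 - s / R\<^sup>2)) (at s)"
      unfolding \<psi>_def using R by (intro always_eventually allI) (auto intro!: derivative_eq_intros simp: field_simps)
    show "((\<lambda>s. - 2 * M / R\<^sup>2 * (1 - s / R\<^sup>2)) has_real_derivative 2 * M / R ^ 4) (at ((norm (x - p))\<^sup>2))"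
      using R by (auto intro!: derivative_eq_intros simp: field_simps)
    have "\<forall>\<^sub>F z in nhds x. z \<in> ball p R"
      using xR by (intro eventually_nhds_in_open) (auto simp: dist_norm norm_minus_commute)
    then show "\<forall>\<^sub>F z in nhds x. v x - M * \<psi> ((norm (x - p))\<^sup>2) \<le> v z - M * \<psi> ((norm (z - p))\<^sup>2)"
      by eventually_elim (use touch in \<open>auto simp: dist_norm norm_minus_commute\<close>)
  qed (fact v)
  have \<sigma>: "0 \<le> \<sigma>" "\<sigma> < 1"
    using xR R by (auto simp: \<sigma>_def power_strict_mono)
  define q where "q = M / R\<^sup>2 * (1 - \<sigma>)"
  have "0 \<le> q" using M \<sigma> by (simp add: q_def)
  then have "real DIM('a) * q \<le> 3 * q" using dim by (intro mult_right_mono) auto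
  moreover have e1: "2 * real DIM('a) * (- 2 * M / R\<^sup>2 * (1 - (norm (x - p))\<^sup>2 / R\<^sup>2)) = - 4 * (real DIM('a) * q)"
    by (simp add: q_def \<sigma>_def)
  moreover have e2: "4 * (norm (x - p))\<^sup>2 * (2 * M / R ^ 4) = M / R\<^sup>2 * (8 * \<sigma>)"
    using R by (simp add: \<sigma>_def field_simps eval_nat_numeral)
  moreover have "M / R\<^sup>2 * (12 - 20 * \<sigma>) = 12 * q - M / R\<^sup>2 * (8 * \<sigma>)"
  proof -
    have "A * (12 - 20 * \<sigma>) = 12 * (A * (1 - \<sigma>)) - A * (8 * \<sigma>)" for A :: real
      by (simp add: algebra_simps)
    then show ?thesis by (simp add: q_def)
  qed
  ultimately have "- laplacian v x \<le> M / R\<^sup>2 * (12 - 20 * \<sigma>)"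
    using lap[unfolded e1 e2] by argo
  then have upper: "\<epsilon> * v x ^ 3 \<le> M / R\<^sup>2 * (12 - 20 * \<sigma>)"
    using super[of x] by (rule order_trans[rotated])
  have "0 < \<epsilon> * v x ^ 3" using \<epsilon> vx by simp
  with upper have "0 < M / R\<^sup>2 * (12 - 20 * \<sigma>)" by linarith
  moreover have "0 < M / R\<^sup>2" using M R by simp
  ultimately have "0 < 12 - 20 * \<sigma>" by (rule zero_less_mult_pos)
  then have \<sigma>': "\<sigma> < 3 / 5" by simp
  have "(2 / 5)\<^sup>2 \<le> (1 - \<sigma>)\<^sup>2" using \<sigma>' by (intro power_mono) auto
  then have "M * (4 / 25) \<le> M * (1 - \<sigma>)\<^sup>2"
    using M by (intro mult_left_mono) (auto simp: power2_eq_square)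
  also have "\<dots> = v x" using \<psi>x by (simp add: M_def \<psi>_def \<sigma>_def)
  finally have Mv: "M \<le> 25 / 4 * v x" by simp
  have "M / R\<^sup>2 * (12 - 20 * \<sigma>) \<le> (25 / 4 * v x) / R\<^sup>2 * 12"
    using Mv M \<sigma> \<sigma>' vx by (intro mult_mono divide_right_mono) auto
  with upper have "\<epsilon> * v x ^ 3 \<le> 75 * v x / R\<^sup>2" by simp
  then have "\<epsilon> * (v x)\<^sup>2 * R\<^sup>2 \<le> 75"
    using vx R by (simp add: field_simps eval_nat_numeral)
  moreover have "\<epsilon> * (m * R)\<^sup>2 \<le> \<epsilon> * (v x * R)\<^sup>2"
    using m(1) m(2)[of x] xR \<epsilon> R by (intro mult_left_mono power_mono mult_right_mono) auto
  ultimately show ?thesis by (simp add: power_mult_distrib mult.assoc)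
qed


section \<open>The Liouville theorem for a single inequality\<close>

text \<open>
  The dimension bound is essential: in dimension 4 and higher there are positive solutions of
  \<open>- \<Delta>v \<ge> \<epsilon> v\<^sup>3\<close>, for instance small multiples of \<open>1 / sqrt (1 + r\<^sup>2)\<close>.
\<close>

lemma cubic_supersolution_eq_0:
  fixes v :: "'a::euclidean_space \<Rightarrow> real"
  assumes dim: "DIM('a) \<le> 3" and v: "C2 v" and nonneg: "\<And>x. 0 \<le> v x"
    and \<epsilon>: "0 < \<epsilon>" and super: "\<And>x. \<epsilon> * v x ^ 3 \<le> - laplacian v x"
  shows "v p = 0"
proof (rule ccontr)
  assume "v p \<noteq> 0"
  then have vp: "0 < v p" using nonneg[of p] by simp
  have "isCont v p"
    using C2_imp_continuous_on[OF v, of UNIV] by (simp add: continuous_on_eq_continuous_at)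
  then obtain d where d: "0 < d" "\<And>x. dist x p < d \<Longrightarrow> dist (v x) (v p) < v p / 2"
    using vp unfolding continuous_at_eps_delta by (meson half_gt_zero)
  define r0 where "r0 = d / 2"
  define c where "c = r0 * (v p / 2)"
  have r0: "0 < r0" and c: "0 < c" using d vp by (auto simp: r0_def c_def)
  have inner: "c / r0 \<le> v x" if "norm (x - p) \<le> r0" for x
  proof -
    have "dist (v x) (v p) < v p / 2"
      using d that by (intro d(2)) (auto simp: r0_def dist_norm)
    then show ?thesis using r0 by (simp add: c_def dist_real_def abs_if split: if_splits)
  qed
  \<comment> \<open>The barrier \<open>c/r\<close> itself is the limit \<open>k \<rightarrow> 0\<close> of the strictly subharmonic ones with \<open>k < 0\<close>; at a
    fixed point \<open>y\<close>, the value of \<open>k\<close> below costs at most \<open>e\<close>.\<close>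
  have decay: "c / norm (y - p) \<le> v y" if y: "r0 \<le> norm (y - p)" for y
  proof (rule field_le_epsilon)
    fix e :: real assume e: "0 < e"
    define r where "r = norm (y - p)"
    have r: "r0 \<le> r" "0 < r" using y r0 by (auto simp: r_def)
    define L where "L = ln (r / r0)"
    define k where "k = - (e * r / (L + 1))"
    have L: "0 \<le> L" using r r0 by (simp add: L_def)
    have "0 < e * r / (L + 1)" using e r L by simp
    then have k: "k < 0" by (simp add: k_def)
    have "(c + k * L) / r \<le> v y"
      unfolding L_def r_def
    proof (rule log_barrier_le_supersolution[OF dim v nonneg r0 c _ _ _ y])
      show "k / norm (x - p) ^ 3 < - laplacian v x" if "r0 < norm (x - p)" for x
      proof -
        have "k / norm (x - p) ^ 3 < 0" using k r0 that by (intro divide_neg_pos) auto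
        also have "0 \<le> \<epsilon> * v x ^ 3" using \<epsilon> nonneg[of x] by simp
        finally show ?thesis using super[of x] by linarith
      qed
    qed (use k c inner in auto)
    moreover have "- e \<le> k * L / r"
    proof -
      have "k * L / r = - (e * (L / (L + 1)))" using r by (simp add: k_def)
      moreover have "e * (L / (L + 1)) \<le> e * 1" using e L by (intro mult_left_mono) auto
      ultimately show ?thesis by simp
    qed
    ultimately show "c / norm (y - p) \<le> v y + e"
      by (simp add: add_divide_distrib r_def)
  qed
  \<comment> \<open>Now \<open>- \<Delta>v \<ge> \<epsilon> (c/r)\<^sup>3\<close>, which leaves room for a barrier with \<open>k > 0\<close>.\<close>
  define k where "k = min c (\<epsilon> * c ^ 3 / 2)"
  have k: "0 < k" "k \<le> c" "k < \<epsilon> * c ^ 3"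
  proof -
    have "0 < \<epsilon> * c ^ 3" using c \<epsilon> by simp
    then show "0 < k" "k \<le> c" "k < \<epsilon> * c ^ 3" using c unfolding k_def by linarith+
  qed
  have log_decay: "(c + k * ln (norm (y - p) / r0)) / norm (y - p) \<le> v y"
    if "r0 \<le> norm (y - p)" for y
  proof (rule log_barrier_le_supersolution[OF dim v nonneg r0 c k(2) _ _ that])
    show "k / norm (x - p) ^ 3 < - laplacian v x" if x: "r0 < norm (x - p)" for x
    proof -
      have "k / norm (x - p) ^ 3 < \<epsilon> * c ^ 3 / norm (x - p) ^ 3"
        using k(3) x r0 by (intro divide_strict_right_mono) auto
      also have "\<dots> = \<epsilon> * (c / norm (x - p)) ^ 3" by (simp add: power_divide)
      also have "\<dots> \<le> \<epsilon> * v x ^ 3"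
        using decay[of x] x r0 c \<epsilon> by (intro mult_left_mono power_mono) auto
      finally show ?thesis using super[of x] by linarith
    qed
  qed (use inner in auto)
  have bounded: "\<epsilon> * (c + k * L)\<^sup>2 \<le> 75" if L: "0 \<le> L" for L
  proof -
    define R where "R = r0 * exp L"
    have R: "r0 \<le> R" "0 < R" using r0 L by (auto simp: R_def)
    \<comment> \<open>The barrier decreases in \<open>r\<close>, so its value at \<open>R\<close> is a lower bound for \<open>v\<close> on the whole ball.\<close>
    have anti: "(c + k * L) / R \<le> (c + k * ln (r / r0)) / r" if r: "r0 \<le> r" "r \<le> R" for r
    proof -
      define W where "W = c + k * ln (r / r0)"
      have "0 \<le> k * ln (r / r0)" using r r0 k by simp
      then have W: "k \<le> W" using k by (simp add: W_def)
      have "L = ln (r / r0) + ln (R / r)"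
        using r r0 R by (simp add: R_def ln_div ln_mult)
      moreover have "ln (R / r) \<le> R / r - 1" using r r0 R by (intro ln_le_minus_one) auto
      ultimately have "k * L \<le> k * (ln (r / r0) + (R / r - 1))" using k by simp
      then have "c + k * L \<le> W + k * (R / r - 1)" by (simp add: W_def algebra_simps)
      also have "\<dots> \<le> W + W * (R / r - 1)"
        using W r r0 by (intro add_left_mono mult_right_mono) auto
      also have "\<dots> = W * R / r" by (simp add: algebra_simps)
      finally show ?thesis using R r r0 by (simp add: W_def field_simps)
    qed
    have "\<epsilon> * ((c + k * L) / R * R)\<^sup>2 \<le> 75"
    proof (rule supersolution_lower_bound_on_ball[OF dim v \<epsilon> super \<open>0 < R\<close>])
      show "0 < (c + k * L) / R" using c k L R by (simp add: add_pos_nonneg)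
      show "(c + k * L) / R \<le> v x" if x: "norm (x - p) \<le> R" for x
      proof (cases "r0 \<le> norm (x - p)")
        case True
        then show ?thesis using anti[OF True x] log_decay[OF True] by linarith
      next
        case False
        then show ?thesis using anti[of r0] inner[of x] R r0 by simp
      qed
    qed
    then show ?thesis using R by simp
  qed
  \<comment> \<open>Since \<open>L \<ge> 1\<close>, the quadratic term is at least \<open>\<epsilon> k\<^sup>2 L > 75\<close>.\<close>
  define L where "L = 76 / (\<epsilon> * k\<^sup>2) + 1"
  have L: "1 \<le> L" using \<epsilon> k by (simp add: L_def)
  have "76 \<le> \<epsilon> * k\<^sup>2 * L" using \<epsilon> k by (simp add: L_def field_simps)
  also have "\<dots> \<le> \<epsilon> * k\<^sup>2 * L\<^sup>2"
    using L \<epsilon> k by (intro mult_left_mono) (auto simp: power2_eq_square)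
  also have "\<dots> = \<epsilon> * (k * L)\<^sup>2" by (simp add: power_mult_distrib)
  also have "\<dots> \<le> \<epsilon> * (c + k * L)\<^sup>2"
    using L \<epsilon> k c by (intro mult_left_mono power_mono) auto
  also have "\<dots> \<le> 75" using bounded[of L] L by simp
  finally show False by simp
qed

section \<open>Weighted sums of components\<close>

lemma partial_weighted_sum:
  fixes u :: "'n::finite \<Rightarrow> 'a::euclidean_space \<Rightarrow> real"
  assumes "\<And>i. u i differentiable (at x)"
  shows "(\<lambda>x. \<Sum>i\<in>UNIV. \<mu> i * u i x) differentiable (at x)"
    and "partial b (\<lambda>x. \<Sum>i\<in>UNIV. \<mu> i * u i x) x = (\<Sum>i\<in>UNIV. \<mu> i * partial b (u i) x)"
proof -
  have d: "((\<lambda>x. \<Sum>i\<in>UNIV. \<mu> i * u i x) has_derivative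
      (\<lambda>h. \<Sum>i\<in>UNIV. \<mu> i * frechet_derivative (u i) (at x) h)) (at x)"
    using assms by (intro has_derivative_sum has_derivative_mult_right) (simp add: frechet_derivative_works)
  then show "(\<lambda>x. \<Sum>i\<in>UNIV. \<mu> i * u i x) differentiable (at x)"
    by (rule differentiableI)
  show "partial b (\<lambda>x. \<Sum>i\<in>UNIV. \<mu> i * u i x) x = (\<Sum>i\<in>UNIV. \<mu> i * partial b (u i) x)"
    using frechet_derivative_at[OF d] by (simp add: partial_def fun_eq_iff)
qed

lemma C1_weighted_sum:
  fixes u :: "'n::finite \<Rightarrow> 'a::euclidean_space \<Rightarrow> real"
  assumes "\<And>i. C1 (u i)"
  shows "C1 (\<lambda>x. \<Sum>i\<in>UNIV. \<mu> i * u i x)"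
    and "partial b (\<lambda>x. \<Sum>i\<in>UNIV. \<mu> i * u i x) = (\<lambda>x. \<Sum>i\<in>UNIV. \<mu> i * partial b (u i) x)"
proof -
  have diff: "u i differentiable (at x)" for i x using assms by (simp add: C1_def)
  show eq: "partial b (\<lambda>x. \<Sum>i\<in>UNIV. \<mu> i * u i x) = (\<lambda>x. \<Sum>i\<in>UNIV. \<mu> i * partial b (u i) x)" for b
    using partial_weighted_sum(2)[of u, OF diff] by (rule ext)
  show "C1 (\<lambda>x. \<Sum>i\<in>UNIV. \<mu> i * u i x)"
    unfolding C1_def eq using partial_weighted_sum(1)[of u, OF diff] assms
    by (auto simp: C1_def intro!: continuous_intros)
qed

lemma C2_weighted_sum:
  fixes u :: "'n::finite \<Rightarrow> 'a::euclidean_space \<Rightarrow> real"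
  assumes u: "\<And>i. C2 (u i)"
  shows "C2 (\<lambda>x. \<Sum>i\<in>UNIV. \<mu> i * u i x)"
    and "laplacian (\<lambda>x. \<Sum>i\<in>UNIV. \<mu> i * u i x) x = (\<Sum>i\<in>UNIV. \<mu> i * laplacian (u i) x)"
proof -
  have C1: "C1 (u i)" "b \<in> Basis \<Longrightarrow> C1 (partial b (u i))" for i b
    using u by (auto simp: C2_def)
  show "C2 (\<lambda>x. \<Sum>i\<in>UNIV. \<mu> i * u i x)"
    unfolding C2_def C1_weighted_sum(2)[of u, OF C1(1)]
    by (intro conjI ballI C1_weighted_sum(1) C1)
  have "laplacian (\<lambda>x. \<Sum>i\<in>UNIV. \<mu> i * u i x) x
      = (\<Sum>b\<in>Basis. \<Sum>i\<in>UNIV. \<mu> i * partial b (partial b (u i)) x)"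
    unfolding laplacian_def C1_weighted_sum(2)[of u, OF C1(1)]
    by (intro sum.cong refl) (simp add: C1_weighted_sum(2)[OF C1(2)])
  also have "\<dots> = (\<Sum>i\<in>UNIV. \<mu> i * laplacian (u i) x)"
    unfolding laplacian_def sum_distrib_left by (rule sum.swap)
  finally show "laplacian (\<lambda>x. \<Sum>i\<in>UNIV. \<mu> i * u i x) x = (\<Sum>i\<in>UNIV. \<mu> i * laplacian (u i) x)" .
qed

section \<open>Coercivity of the cubic form\<close>

definition weighted_cubic_form :: "real ^ 'n ^ 'n \<Rightarrow> real ^ 'n \<Rightarrow> real ^ 'n \<Rightarrow> real" where
  "weighted_cubic_form B \<mu> c = (\<Sum>i\<in>UNIV. \<Sum>j\<in>UNIV. B $ i $ j * (c $ j)\<^sup>2 * c $ i * \<mu> $ i)"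

text \<open>
  The form is continuous, so it has a positive minimum \<open>\<delta>\<close> on the compact set of unit vectors in the
  cone; homogeneity of degree 3 extends the bound to the whole cone.
\<close>

lemma weighted_cubic_form_coercive:
  fixes B :: "real ^ 'n ^ 'n"
  assumes pos: "\<And>c. c \<in> nonneg_cone \<Longrightarrow> c \<noteq> 0 \<Longrightarrow> 0 < weighted_cubic_form B \<mu> c"
  obtains \<delta> where "0 < \<delta>" "\<And>c. c \<in> nonneg_cone \<Longrightarrow> \<delta> * norm c ^ 3 \<le> weighted_cubic_form B \<mu> c"
proof -
  let ?K = "sphere 0 1 \<inter> nonneg_cone :: (real ^ 'n) set"
  have cone: "(nonneg_cone :: (real ^ 'n) set) = (\<Inter>i. {c. 0 \<le> c $ i})"
    by (auto simp: nonneg_cone_def)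
  have "closed (nonneg_cone :: (real ^ 'n) set)"
    unfolding cone by (intro closed_INT ballI closed_Collect_le continuous_intros)
  then have "compact ?K" by (intro compact_Int_closed) auto
  moreover have "axis undefined 1 \<in> ?K"
    by (auto simp: nonneg_cone_def axis_def norm_axis_1[unfolded axis_def])
  moreover have "continuous_on ?K (weighted_cubic_form B \<mu>)"
    unfolding weighted_cubic_form_def by (intro continuous_intros)
  ultimately obtain c0 where c0: "c0 \<in> ?K"
    and min: "\<And>c. c \<in> ?K \<Longrightarrow> weighted_cubic_form B \<mu> c0 \<le> weighted_cubic_form B \<mu> c"
    using continuous_attains_inf[of ?K] by blast
  show thesis
  proof (rule that[of "weighted_cubic_form B \<mu> c0"])
    show "0 < weighted_cubic_form B \<mu> c0" using c0 by (intro pos) auto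
    fix c :: "real ^ 'n" assume c: "c \<in> nonneg_cone"
    have hom: "weighted_cubic_form B \<mu> (t *\<^sub>R c) = t ^ 3 * weighted_cubic_form B \<mu> c" for t
      by (simp add: weighted_cubic_form_def sum_distrib_left power_mult_distrib mult_ac eval_nat_numeral)
    show "weighted_cubic_form B \<mu> c0 * norm c ^ 3 \<le> weighted_cubic_form B \<mu> c"
    proof (cases "c = 0")
      case True
      then show ?thesis by (simp add: weighted_cubic_form_def)
    next
      case False
      then have "(1 / norm c) *\<^sub>R c \<in> ?K"
        using c by (auto simp: nonneg_cone_def)
      from min[OF this] show ?thesis
        using False unfolding hom by (simp add: field_simps)
    qed
  qed
qed

section \<open>Nonexistence of nontrivial solutions\<close>

theorem proposition1p1:
  fixes B :: "real ^ 'n ^ 'n"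
  assumes "CARD('N::finite) \<in> {1, 2, 3}"
    and "symmetric_matrix B"
    and "strictly_cubically_copositive B"
  shows "\<not> (\<exists>u :: 'n \<Rightarrow> real ^ 'N \<Rightarrow> real. nonneg_solution B u \<and> nontrivial u)"
proof
  assume "\<exists>u :: 'n \<Rightarrow> real ^ 'N \<Rightarrow> real. nonneg_solution B u \<and> nontrivial u"
  then obtain u :: "'n \<Rightarrow> real ^ 'N \<Rightarrow> real" where u: "nonneg_solution B u" and "nontrivial u"
    by blast
  have C2: "C2 (u i)" and nonneg: "0 \<le> u i x"
    and eq: "- laplacian (u i) x = (\<Sum>j\<in>UNIV. B $ i $ j * (u j x)\<^sup>2 * u i x)" for i x
    using u by (auto simp: nonneg_solution_def)
  obtain \<mu> where \<mu>: "\<mu> \<in> nonneg_cone"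
    and pos: "\<And>c. c \<in> nonneg_cone \<Longrightarrow> c \<noteq> 0 \<Longrightarrow> 0 < weighted_cubic_form B \<mu> c"
    using assms(3) unfolding strictly_cubically_copositive_def weighted_cubic_form_def by blast
  obtain \<delta> where \<delta>: "0 < \<delta>"
    "\<And>c. c \<in> nonneg_cone \<Longrightarrow> \<delta> * norm c ^ 3 \<le> weighted_cubic_form B \<mu> c"
    using weighted_cubic_form_coercive[OF pos] by blast
  define U where "U x = (\<chi> i. u i x)" for x
  define v where "v = (\<lambda>x. \<Sum>i\<in>UNIV. \<mu> $ i * u i x)"
  have U: "U x \<in> nonneg_cone" for x by (simp add: U_def nonneg_cone_def nonneg)
  have v_nonneg: "0 \<le> v x" for x
    using \<mu> nonneg unfolding v_def nonneg_cone_def by (auto intro!: sum_nonneg)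
  have lap: "- laplacian v x = weighted_cubic_form B \<mu> (U x)" for x
  proof -
    have "- laplacian v x = (\<Sum>i\<in>UNIV. \<mu> $ i * (- laplacian (u i) x))"
      unfolding v_def C2_weighted_sum(2)[of u, OF C2] by (simp add: sum_negf)
    also have "\<dots> = weighted_cubic_form B \<mu> (U x)"
      unfolding eq weighted_cubic_form_def by (simp add: U_def sum_distrib_left mult_ac)
    finally show ?thesis .
  qed
  \<comment> \<open>Adding 1 to \<open>norm \<mu>\<close> keeps the denominator positive without an argument that \<open>\<mu> \<noteq> 0\<close>.\<close>
  define \<epsilon> where "\<epsilon> = \<delta> / (norm \<mu> + 1) ^ 3"
  have "0 < norm \<mu> + 1" by (simp add: add_nonneg_pos)
  then have \<epsilon>: "0 < \<epsilon>" using \<delta>(1) by (simp add: \<epsilon>_def)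
  have super: "\<epsilon> * v x ^ 3 \<le> - laplacian v x" for x
  proof -
    have "v x = \<mu> \<bullet> U x" by (simp add: v_def U_def inner_vec_def)
    also have "\<dots> \<le> norm \<mu> * norm (U x)" by (rule norm_cauchy_schwarz)
    also have "\<dots> \<le> (norm \<mu> + 1) * norm (U x)" by (simp add: mult_right_mono)
    finally have "v x ^ 3 \<le> ((norm \<mu> + 1) * norm (U x)) ^ 3"
      using v_nonneg by (intro power_mono)
    then have "\<epsilon> * v x ^ 3 \<le> \<epsilon> * ((norm \<mu> + 1) * norm (U x)) ^ 3"
      using \<epsilon> by simp
    also have "\<dots> = \<delta> * norm (U x) ^ 3"
      using \<open>0 < norm \<mu> + 1\<close> by (simp add: \<epsilon>_def power_mult_distrib)
    also have "\<dots> \<le> - laplacian v x" unfolding lap by (rule \<delta>(2)[OF U])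
    finally show ?thesis .
  qed
  have "DIM(real ^ 'N) \<le> 3" using assms(1) by auto
  moreover have "C2 v" unfolding v_def by (rule C2_weighted_sum(1)[of u, OF C2])
  ultimately have "v x = 0" for x
    using cubic_supersolution_eq_0[OF _ _ v_nonneg \<epsilon> super] by blast
  then have v0: "v = (\<lambda>x. 0)" by blast
  have "laplacian v x = 0" for x
    using C2_weighted_sum(2)[of "\<lambda>_::'n. v" "\<lambda>_. 0" x] \<open>C2 v\<close> by (simp add: v0)
  then have "weighted_cubic_form B \<mu> (U x) = 0" for x using lap[of x] by simp
  then have "U x = 0" for x using pos[OF U] by (metis less_irrefl)
  then have "u i x = 0" for i x by (simp add: U_def vec_eq_iff)
  then have "u i = (\<lambda>x. 0)" for i by blast
  then show False using \<open>nontrivial u\<close> by (simp add: nontrivial_def)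
qed

end
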